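(* Let $S^0_{\mathbf N} = \{(0,n) \mid n \ge 1\} \subset \mathrm{Sym}(\mathbf N)$ and, for every $n \ge 1$, let $S^0_n = \{(0,i) \mid 1 \le i \le n-1\} \subset \mathrm{Sym}(n)$, where $\mathrm{Sym}(n) = \mathrm{Sym}(\{0,1,\dots,n-1\})$. Then (i) $$C_{\mathrm{Sym}(\mathbf N), S^0_{\mathbf N}}(q) = 1 + \sum_{k=1}^\infty q^{3k-2} \prod_{j=1}^k \frac{1}{1-q^j}$$ $$= 1 + q + q^2 + q^3 + 2q^4 + 2q^5 + 3q^6 + 4q^7 + 5q^8 + 6q^9 + 9q^{10} + 10q^{11} + 13q^{12} + 17q^{13} + 21q^{14} + 25q^{15} + 33q^{16} + 39q^{17} + 49q^{18} + 60q^{19} + 73q^{20} + 88q^{21} + 110q^{22} + 130q^{23} + 158q^{24} + \cdots;$$ (ii) for every $n \ge 1$, $$C_{\mathrm{Sym}(n), S^0_n}(q) = 1 + \sum_{k=1}^{\lfloor n/2 \rfloor} q^{2k-2} \sum_{j=k}^{n} p_k(j) q^j.$$ Moreover, when $n \to \infty$, the polynomials $C_{\mathrm{Sym}(n), S^0_n}(q)$ of (ii) converge coefficientwise towards the series $C_{\mathrm{Sym}(\mathbf N), S^0_{\mathbf N}}(q)$ of (i).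
   Context: $\mathbf N = \{0,1,2,\dots\}$. For a group $G$ generated by a set $S$: the word length $\ell_{G,S}(g)$ is the smallest $n \ge 0$ such that $g = s_1 \cdots s_n$ with $s_i \in S \cup S^{-1}$; the conjugacy length $\kappa_{G,S}(g)$ is the minimum of $\ell_{G,S}(h)$ over all $h$ in the conjugacy class of $g$; $\gamma_{G,S}(n)$ is the number of conjugacy classes of $G$ consisting of elements $g$ with $\kappa_{G,S}(g) = n$. When $\gamma_{G,S}(n)$ is finite for all $n$, the conjugacy growth series (called conjugacy growth polynomial when $G$ is finite) is $C_{G,S}(q) = \sum_{n=0}^\infty \gamma_{G,S}(n) q^n$. For a non-empty set $X$, $\mathrm{Sym}(X)$ is the group of permutations of $X$ with finite support, and $(x,y)$ denotes the transposition exchanging $x$ and $y$. The sets $S^0_{\mathbf N}$ and $S^0_n$ generate $\mathrm{Sym}(\mathbf N)$ and $\mathrm{Sym}(n)$ respectively. $p_k(j)$ is the number of partitions of $j$ into exactly $k$ positive parts.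
   Formalization: In (ii) the inner sum runs over j from k to n−k instead of k to n: the printed formula is false for every n ≥ 2 (for n = 2 it gives 1+q+q², but Sym(2) has two conjugacy classes and polynomial 1+q). *)

theory Defs
  imports
    "HOL-Computational_Algebra.Formal_Power_Series"
    "HOL-Algebra.Generated_Groups"
    "HOL-Combinatorics.Permutations"
    "HOL-Library.Multiset"
begin

definition word_length :: "('a, 'b) monoid_scheme \<Rightarrow> 'a set \<Rightarrow> 'a \<Rightarrow> nat" where
  "word_length G S g = (LEAST n. \<exists>ss. length ss = n \<and> set ss \<subseteq> S \<union> m_inv G ` S
     \<and> g = foldr (mult G) ss \<one>\<^bsub>G\<^esub>)"

definition conj_class :: "('a, 'b) monoid_scheme \<Rightarrow> 'a \<Rightarrow> 'a set" where
  "conj_class G g = {h \<otimes>\<^bsub>G\<^esub> g \<otimes>\<^bsub>G\<^esub> inv\<^bsub>G\<^esub> h | h. h \<in> carrier G}"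

definition conj_classes :: "('a, 'b) monoid_scheme \<Rightarrow> 'a set set" where
  "conj_classes G = conj_class G ` carrier G"

definition conj_length :: "('a, 'b) monoid_scheme \<Rightarrow> 'a set \<Rightarrow> 'a \<Rightarrow> nat" where
  "conj_length G S g = (LEAST n. \<exists>h \<in> conj_class G g. word_length G S h = n)"

definition conj_classes_of_length :: "('a, 'b) monoid_scheme \<Rightarrow> 'a set \<Rightarrow> nat \<Rightarrow> 'a set set" where
  "conj_classes_of_length G S n = {K \<in> conj_classes G. \<forall>g \<in> K. conj_length G S g = n}"

text \<open>
  The next two definitions are only meaningful if \<open>conj_classes_of_length G S n\<close> is finite for
  all \<open>n\<close>, since \<open>card\<close> maps infinite sets to \<open>0\<close>.
  Real coefficients make both division of power series and limits of coefficients available.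
\<close>

definition conj_growth :: "('a, 'b) monoid_scheme \<Rightarrow> 'a set \<Rightarrow> nat \<Rightarrow> nat" where
  "conj_growth G S n = card (conj_classes_of_length G S n)"

definition conj_growth_series :: "('a, 'b) monoid_scheme \<Rightarrow> 'a set \<Rightarrow> real fps" where
  "conj_growth_series G S = Abs_fps (\<lambda>n. real (conj_growth G S n))"

text \<open>
  A permutation of \<open>X\<close> is a function on the whole type that is the identity outside \<open>X\<close>.
\<close>

definition fin_sym :: "'a set \<Rightarrow> ('a \<Rightarrow> 'a) monoid" where
  "fin_sym X = \<lparr> carrier = {p. p permutes X \<and> finite {x. p x \<noteq> x}}, mult = (\<circ>), one = id \<rparr>"

definition star_gens_nat :: "(nat \<Rightarrow> nat) set" where
  "star_gens_nat = {Transposition.transpose 0 i | i. 1 \<le> i}"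

definition star_gens :: "nat \<Rightarrow> (nat \<Rightarrow> nat) set" where
  "star_gens n = {Transposition.transpose 0 i | i. 1 \<le> i \<and> i \<le> n - 1}"

text \<open>
  A conjugacy class of \<open>Sym(n)\<close> with \<open>k \<ge> 1\<close> non-trivial cycles of total size \<open>m \<le> n\<close> has conjugacy
  length \<open>m + k - 2\<close> and corresponds, by shortening each non-trivial cycle by one, to a partition
  of \<open>j = m - k \<le> n - k\<close> into \<open>k\<close> positive parts. So in the conjugacy growth polynomial of
  \<open>Sym(n)\<close> the index \<open>j\<close> runs from \<open>k\<close> to \<open>n - k\<close>. The source prints \<open>n\<close> as upper limit, which is
  wrong: for \<open>n = 2\<close> it would give \<open>1 + q + q\<^sup>2\<close> instead of \<open>1 + q\<close>.
\<close>

definition num_partitions :: "nat \<Rightarrow> nat \<Rightarrow> nat" where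
  "num_partitions k j = card {M :: nat multiset. size M = k \<and> (\<forall>i \<in># M. 0 < i) \<and> sum_mset M = j}"

lemma finite_partitions:
  "finite {M :: nat multiset. size M = k \<and> (\<forall>i \<in># M. 0 < i) \<and> sum_mset M = j}"
proof (rule finite_subset)
  have "M \<in> mset ` {xs. set xs \<subseteq> {..j} \<and> length xs = k}"
    if "size M = k" "sum_mset M = j" for M :: "nat multiset"
  proof -
    obtain xs where xs: "M = mset xs"
      by (metis ex_mset)
    have "set xs \<subseteq> {..j}"
      using that xs member_le_sum_list[of _ xs] by (auto simp: sum_mset_sum_list)
    then show ?thesis
      using that xs by auto
  qed
  then show "{M :: nat multiset. size M = k \<and> (\<forall>i \<in># M. 0 < i) \<and> sum_mset M = j}
      \<subseteq> mset ` {xs. set xs \<subseteq> {..j} \<and> length xs = k}"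
    by blast
  show "finite (mset ` {xs. set xs \<subseteq> {..j} \<and> length xs = k})"
    by (simp add: finite_lists_length_eq)
qed

lemma group_fin_sym: "group (fin_sym X)"
proof (rule groupI)
  fix p q
  assume "p \<in> carrier (fin_sym X)" "q \<in> carrier (fin_sym X)"
  then have "p permutes X" "q permutes X" "finite {x. p x \<noteq> x}" "finite {x. q x \<noteq> x}"
    by (auto simp: fin_sym_def)
  moreover from this have "finite {x. (p \<circ> q) x \<noteq> x}"
    by (rule_tac finite_subset[of _ "{x. p x \<noteq> x} \<union> {x. q x \<noteq> x}"]) auto
  ultimately show "p \<otimes>\<^bsub>fin_sym X\<^esub> q \<in> carrier (fin_sym X)"
    by (auto simp: fin_sym_def permutes_compose)
next
  fix p
  assume p: "p \<in> carrier (fin_sym X)"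
  then have perm: "p permutes X" and fin: "finite {x. p x \<noteq> x}"
    by (auto simp: fin_sym_def)
  have "{x. inv_into UNIV p x \<noteq> x} = {x. p x \<noteq> x}"
    using permutes_inverses[OF perm] by (metis (no_types, opaque_lifting))
  then show "\<exists>q \<in> carrier (fin_sym X). q \<otimes>\<^bsub>fin_sym X\<^esub> p = \<one>\<^bsub>fin_sym X\<^esub>"
    using perm fin permutes_inv[OF perm] permutes_inv_o(2)[OF perm]
    by (intro bexI[of _ "inv_into UNIV p"]) (auto simp: fin_sym_def)
qed (auto simp: fin_sym_def permutes_id comp_assoc)

lemma fin_sym_generated_by_stars:
  assumes gens: "S = {Transposition.transpose z i | i. i \<in> X \<and> i \<noteq> z}" and z: "z \<in> X"
  shows "generate (fin_sym X) S = carrier (fin_sym X)"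
proof
  interpret group "fin_sym X"
    by (rule group_fin_sym)
  have "Transposition.transpose z i \<in> carrier (fin_sym X)" if "i \<in> X" for i
  proof -
    have "finite {x. Transposition.transpose z i x \<noteq> x}"
      by (rule finite_subset[of _ "{z, i}"]) (auto simp: transpose_def split: if_splits)
    then show ?thesis
      using that z by (simp add: fin_sym_def permutes_swap_id)
  qed
  then have S: "S \<subseteq> carrier (fin_sym X)"
    using gens by auto
  then show "generate (fin_sym X) S \<subseteq> carrier (fin_sym X)"
    by (rule generate_incl)
  have id: "id \<in> generate (fin_sym X) S"
    using generate.one[of "fin_sym X" S] by (simp add: fin_sym_def)
  have comp: "p \<circ> q \<in> generate (fin_sym X) S"
    if "p \<in> generate (fin_sym X) S" "q \<in> generate (fin_sym X) S" for p q
    using generate.eng[OF that] by (simp add: fin_sym_def)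
  have star: "Transposition.transpose z i \<in> generate (fin_sym X) S" if "i \<in> X" for i
    using that id gens by (cases "i = z") (auto intro!: generate.incl)
  have transp: "Transposition.transpose a b \<in> generate (fin_sym X) S" if "a \<in> X" "b \<in> X" for a b
  proof (cases "a = b \<or> a = z \<or> b = z")
    case True
    then show ?thesis
      using that id star by (auto simp: transpose_commute)
  next
    case False
    then have "Transposition.transpose a b = Transposition.transpose z a \<circ> (Transposition.transpose z b \<circ> Transposition.transpose z a)"
      by (auto simp: fun_eq_iff transpose_def)
    then show ?thesis
      using that star comp by simp
  qed
  show "carrier (fin_sym X) \<subseteq> generate (fin_sym X) S"
  proof
    fix p
    assume "p \<in> carrier (fin_sym X)"
    then have p: "p permutes X" "finite {x. p x \<noteq> x}"
      by (auto simp: fin_sym_def)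
    have sub: "{x. p x \<noteq> x} \<subseteq> X"
      using permutes_not_in[OF p(1)] by blast
    have "p permutes {x. p x \<noteq> x}"
      using p(1) by (auto simp: permutes_def)
    from this p(2) show "p \<in> generate (fin_sym X) S"
    proof (induction rule: permutes_induct[consumes 2])
      case id
      show ?case by (rule \<open>id \<in> generate (fin_sym X) S\<close>)
    next
      case (swap a b q)
      then show ?case
        using comp transp sub by blast
    qed
  qed
qed

lemma generate_star_gens_nat:
  "generate (fin_sym UNIV) star_gens_nat = carrier (fin_sym UNIV)"
  by (rule fin_sym_generated_by_stars[where z = 0]) (auto simp: star_gens_nat_def)

lemma generate_star_gens:
  "1 \<le> n \<Longrightarrow> generate (fin_sym {..<n}) (star_gens n) = carrier (fin_sym {..<n})"
  by (rule fin_sym_generated_by_stars[where z = 0]) (force simp: star_gens_def)+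

end

theory Submission
  imports Defs "HOL-Combinatorics.Cycles" "HOL-Combinatorics.Orbits"
begin

text \<open>
  Conjugacy classes of the finitary symmetric group correspond to multisets of parts, where a cycle
  of length \<open>l \<ge> 2\<close> contributes the part \<open>l - 1\<close>. In a word of star transpositions \<open>(z, i)\<close>, every
  moved point other than \<open>z\<close> occurs as a letter, and every cycle avoiding \<open>z\<close> contains a letter that
  occurs twice. So a permutation with \<open>k\<close> non-trivial cycles of total size \<open>m\<close> has length \<open>m + k - 2\<close>
  if it moves \<open>z\<close> and \<open>m + k\<close> otherwise, and a non-trivial class has conjugacy length \<open>m + k - 2\<close>. What
  remains is the generating function of partitions into exactly \<open>k\<close> parts: remove a part \<open>1\<close>
  or decrease all parts by \<open>1\<close>.
\<close>

section \<open>Cycle types of finitary permutations\<close>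

definition cycle_prod :: "'a list list \<Rightarrow> 'a \<Rightarrow> 'a" where
  "cycle_prod css = foldr (\<lambda>c p. cycle_of_list c \<circ> p) css id"

lemma cycle_prod_Nil [simp]: "cycle_prod [] = id"
  and cycle_prod_Cons [simp]: "cycle_prod (c # css) = cycle_of_list c \<circ> cycle_prod css"
  by (simp_all add: cycle_prod_def)

text \<open>Distinctness of the concatenation covers both the entries of each list and the
  disjointness of the lists. As trivial cycles are excluded, the listed points are exactly the moved
  ones (\<open>cycle_prod_moved\<close>).\<close>

definition cycle_family :: "'a set \<Rightarrow> 'a list list \<Rightarrow> bool" where
  "cycle_family X css \<longleftrightarrow>
     distinct (concat css) \<and> set (concat css) \<subseteq> X \<and> (\<forall>c \<in> set css. 2 \<le> length c)"

lemma cycle_prod_outside: "x \<notin> set (concat css) \<Longrightarrow> cycle_prod css x = x"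
  by (induction css) (auto simp: id_outside_supp)

lemma cycle_prod_permutes: "cycle_prod css permutes set (concat css)"
proof (induction css)
  case (Cons c css)
  have "cycle_of_list c permutes set (concat (c # css))"
    by (rule permutes_subset[OF cycle_permutes]) simp
  moreover have "cycle_prod css permutes set (concat (c # css))"
    by (rule permutes_subset[OF Cons]) simp
  ultimately show ?case
    unfolding cycle_prod_Cons by (intro permutes_compose)
qed (simp add: permutes_id[unfolded id_def] id_def)

lemma cycle_prod_inside:
  assumes "distinct (concat css)" "c \<in> set css" "x \<in> set c"
  shows "cycle_prod css x = cycle_of_list c x"
  using assms
proof (induction css)
  case (Cons d css)
  show ?case
  proof (cases "x \<in> set d")
    case True
    then have "x \<notin> set (concat css)" using Cons.prems by auto
    moreover have "c = d" using True Cons.prems by (auto simp: disjoint_iff)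
    ultimately show ?thesis by (simp add: cycle_prod_outside)
  next
    case False
    then have "c \<in> set css" using Cons.prems by auto
    moreover have "cycle_of_list c x \<in> set c"
      using permutes_in_image[OF cycle_permutes] Cons.prems by metis
    ultimately show ?thesis
      using Cons by (auto intro: id_outside_supp)
  qed
qed simp

text \<open>Disjoint cycles commute: at a given point only the one list containing it acts. This
  permits reordering the cycles.\<close>

lemma cycle_prod_cong:
  assumes "distinct (concat css)" "distinct (concat dss)" "set css = set dss"
  shows "cycle_prod css = cycle_prod dss"
proof
  fix x
  show "cycle_prod css x = cycle_prod dss x"
  proof (cases "x \<in> set (concat css)")
    case True
    then obtain c where "c \<in> set css" "x \<in> set c" by auto
    then show ?thesis using assms by (simp add: cycle_prod_inside)
  next
    case False
    then show ?thesis using assms by (auto simp: cycle_prod_outside)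
  qed
qed

text \<open>Inserting \<open>inv_into UNIV h \<circ> h\<close> between the factors reduces this to
  relabelling a single cycle.\<close>

lemma cycle_prod_conjugate:
  assumes "distinct (concat css)" "bij h"
  shows "h \<circ> cycle_prod css \<circ> inv_into UNIV h = cycle_prod (map (map h) css)"
  using assms(1)
proof (induction css)
  case Nil
  show ?case using assms(2) by (simp add: fun_eq_iff bij_is_surj surj_f_inv_f)
next
  case (Cons c css)
  have "h \<circ> cycle_prod (c # css) \<circ> inv_into UNIV h
      = (h \<circ> cycle_of_list c \<circ> inv_into UNIV h) \<circ> (h \<circ> cycle_prod css \<circ> inv_into UNIV h)"
    using assms(2) by (simp add: fun_eq_iff bij_is_inj)
  also have "\<dots> = cycle_of_list (map h c) \<circ> cycle_prod (map (map h) css)"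
  proof -
    have "h \<circ> cycle_of_list c \<circ> inv_into UNIV h = cycle_of_list (map h c)"
      using Cons.prems assms(2) by (simp add: conjugation_of_cycle)
    moreover have "h \<circ> cycle_prod css \<circ> inv_into UNIV h = cycle_prod (map (map h) css)"
      by (rule Cons.IH) (use Cons.prems in simp)
    ultimately show ?thesis by (simp only:)
  qed
  finally show ?case by (simp only: list.map cycle_prod_Cons)
qed

text \<open>The cycles come from \<open>cycle_decomposition\<close>. Lists of length at most 1 may
  occur there; they denote the identity and are dropped.\<close>

lemma cycle_family_exists:
  assumes "p permutes X" "finite {x. p x \<noteq> x}"
  obtains css where "cycle_family X css" "p = cycle_prod css"
proof -
  have sub: "{x. p x \<noteq> x} \<subseteq> X"
    using assms(1) by (auto simp: permutes_def)
  have "p permutes {x. p x \<noteq> x}"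
    using assms(1) by (auto simp: permutes_def)
  then have "cycle_decomp {x. p x \<noteq> x} p"
    using assms(2) by (intro cycle_decomposition)
  then have "\<exists>css. cycle_family {x. p x \<noteq> x} css \<and> p = cycle_prod css"
  proof (induction rule: cycle_decomp.induct)
    case empty
    show ?case by (rule exI[of _ "[]"]) (simp add: cycle_family_def)
  next
    case (comp I p cs)
    then obtain css where css: "cycle_family I css" "p = cycle_prod css" by blast
    show ?case
    proof (cases "2 \<le> length cs")
      case True
      with css comp show ?thesis
        by (intro exI[of _ "cs # css"]) (auto simp: cycle_family_def)
    next
      case False
      then have "cycle_of_list cs = id"
        by (cases cs rule: cycle_of_list.cases) auto
      with css show ?thesis
        by (intro exI[of _ css]) (auto simp: cycle_family_def)
    qed
  qed
  then show thesis
    using that sub by (auto simp: cycle_family_def)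
qed

text \<open>By \<open>cyclic_rotation\<close> the n-th power sends the first entry to the entry at
  index n modulo the length, so the first entry runs through the whole list. Cyclicity then gives
  the same orbit for every other entry.\<close>

lemma orbit_cycle_of_list:
  assumes "distinct c" "x \<in> set c"
  shows "orbit (cycle_of_list c) x = set c"
proof -
  have c: "c \<noteq> []" using assms(2) by auto
  have pow: "(cycle_of_list c ^^ n) (c ! 0) = c ! (n mod length c)" for n
  proof -
    have "(cycle_of_list c ^^ n) (c ! 0) = map (cycle_of_list c ^^ n) c ! 0"
      using c by simp
    also have "\<dots> = c ! (n mod length c)"
      using c by (simp only: cyclic_rotation[OF assms(1)]) (simp add: nth_rotate)
    finally show ?thesis .
  qed
  have "orbit (cycle_of_list c) (c ! 0) = {(cycle_of_list c ^^ n) (c ! 0) | n. True}"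
    by (rule orbit_altdef_permutation[OF permutation_of_cycle])
  also have "\<dots> = set c"
  proof -
    have "(\<exists>n. x = c ! (n mod length c)) \<longleftrightarrow> x \<in> set c" for x
      using c by (metis in_set_conv_nth length_greater_0_conv mod_less mod_less_divisor)
    then show ?thesis by (auto simp: pow)
  qed
  finally have "cyclic_on (cycle_of_list c) (set c)"
    unfolding cyclic_on_def using c by (metis length_greater_0_conv nth_mem)
  then show ?thesis
    using assms(2) by (rule orbit_cyclic_eq3)
qed

lemma orbit_cycle_prod:
  assumes "distinct (concat css)" "c \<in> set css" "x \<in> set c"
  shows "orbit (cycle_prod css) x = set c"
proof -
  have "distinct c" using assms by (auto simp: distinct_concat_iff)
  then have o: "orbit (cycle_of_list c) x = set c"
    using assms(3) by (rule orbit_cycle_of_list)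
  have "orbit (cycle_of_list c) x = orbit (cycle_prod css) x"
    using assms o by (intro orbit_cong0[of _ "set c"])
      (auto simp: cycle_prod_inside cycle_permutes permutes_in_image)
  then show ?thesis using o by simp
qed

text \<open>A fixed entry would have a one-point orbit, but its orbit is its whole cycle, which has
  at least two points.\<close>

lemma cycle_prod_moved:
  assumes "cycle_family X css"
  shows "{x. cycle_prod css x \<noteq> x} = set (concat css)"
proof -
  have "cycle_prod css x \<noteq> x" if x: "x \<in> set c" "c \<in> set css" for x c
  proof
    assume "cycle_prod css x = x"
    then have "orbit (cycle_prod css) x = {x}"
      by (simp add: orbit_eq_singleton_iff)
    moreover have "orbit (cycle_prod css) x = set c"
      using assms x by (intro orbit_cycle_prod) (auto simp: cycle_family_def)
    moreover have "card (set c) \<ge> 2"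
      using assms x by (auto simp: cycle_family_def distinct_concat_iff distinct_card)
    ultimately show False by simp
  qed
  then show ?thesis
    using cycle_prod_outside[of _ css] by fastforce
qed

text \<open>Defined through orbits, hence independent of any chosen decomposition. Each orbit counts
  once, and \<open>image_mset\<close> keeps the multiplicity of equal sizes. Lowering sizes by one
  turns k non-trivial cycles into k positive parts.\<close>

definition shifted_cycle_type :: "('a \<Rightarrow> 'a) \<Rightarrow> nat multiset" where
  "shifted_cycle_type p = image_mset (\<lambda>A. card A - 1) (mset_set (orbit p ` {x. p x \<noteq> x}))"

lemma shifted_cycle_type_cycle_prod:
  assumes "cycle_family X css"
  shows "shifted_cycle_type (cycle_prod css) = mset (map (\<lambda>c. length c - 1) css)"
proof -
  have d: "distinct (concat css)" "\<forall>c \<in> set css. 2 \<le> length c"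
    using assms by (auto simp: cycle_family_def)
  \<comment> \<open>\<open>mset_set\<close> counts each orbit once, so different cycles must give
    different sets; they do, being non-empty and disjoint.\<close>
  have "distinct (map set css)"
    using d
  proof (induction css)
    case (Cons c css)
    then have "set c \<noteq> {}" by auto
    moreover have "set c \<inter> set d = {}" if "d \<in> set css" for d
      using Cons.prems that by auto
    ultimately show ?case using Cons by fastforce
  qed simp
  moreover have "orbit (cycle_prod css) ` {x. cycle_prod css x \<noteq> x} = set (map set css)"
  proof -
    have "\<exists>x. x \<in> set c" if "c \<in> set css" for c
      using d that by (metis Zero_not_Suc last_in_set le_zero_eq list.size(3) numeral_2_eq_2)
    then show ?thesis
      unfolding cycle_prod_moved[OF assms]
      by (auto simp: orbit_cycle_prod[OF d(1)] image_iff)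
  qed
  ultimately have "shifted_cycle_type (cycle_prod css) = image_mset (\<lambda>A. card A - 1) (mset (map set css))"
    unfolding shifted_cycle_type_def by (simp only: mset_set_set)
  also have "\<dots> = mset (map (\<lambda>c. length c - 1) css)"
  proof -
    have "map (\<lambda>A. card A - 1) (map set css) = map (\<lambda>c. length c - 1) css"
      using d by (auto simp: distinct_concat_iff distinct_card)
    then show ?thesis by (metis mset_map)
  qed
  finally show ?thesis .
qed

section \<open>Conjugacy in the finitary symmetric group\<close>

lemma inv_fin_sym:
  assumes "p \<in> carrier (fin_sym X)"
  shows "inv\<^bsub>fin_sym X\<^esub> p = inv_into UNIV p"
proof -
  interpret group "fin_sym X" by (rule group_fin_sym)
  have p: "p permutes X" "finite {x. p x \<noteq> x}"
    using assms by (auto simp: fin_sym_def)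
  have "{x. inv_into UNIV p x \<noteq> x} = {x. p x \<noteq> x}"
    using permutes_inverses[OF p(1)] by (metis (no_types, opaque_lifting))
  then have "inv_into UNIV p \<in> carrier (fin_sym X)"
    using p permutes_inv[OF p(1)] by (simp add: fin_sym_def)
  moreover have "inv_into UNIV p \<otimes>\<^bsub>fin_sym X\<^esub> p = \<one>\<^bsub>fin_sym X\<^esub>"
    using permutes_inv_o(2)[OF p(1)] by (simp add: fin_sym_def)
  ultimately show ?thesis
    using assms by (intro inv_equality)
qed

lemma conj_class_fin_sym:
  "conj_class (fin_sym X) p =
     {h \<circ> p \<circ> inv_into UNIV h | h. h permutes X \<and> finite {x. h x \<noteq> x}}"
proof -
  have "h \<otimes>\<^bsub>fin_sym X\<^esub> p \<otimes>\<^bsub>fin_sym X\<^esub> inv\<^bsub>fin_sym X\<^esub> h = h \<circ> p \<circ> inv_into UNIV h"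
    if "h \<in> carrier (fin_sym X)" for h
    using inv_fin_sym[OF that] by (simp add: fin_sym_def)
  moreover have "carrier (fin_sym X) = {h. h permutes X \<and> finite {x. h x \<noteq> x}}"
    by (simp add: fin_sym_def)
  ultimately show ?thesis
    unfolding conj_class_def by force
qed

lemma cycle_prod_in_carrier:
  assumes "set (concat css) \<subseteq> X"
  shows "cycle_prod css \<in> carrier (fin_sym X)"
proof -
  have "finite {x. cycle_prod css x \<noteq> x}"
    by (rule finite_subset[of _ "set (concat css)"]) (use cycle_prod_outside in fastforce)+
  then show ?thesis
    using permutes_subset[OF cycle_prod_permutes assms] by (simp add: fin_sym_def)
qed

lemma cycle_family_of_carrier:
  assumes "p \<in> carrier (fin_sym X)"
  obtains css where "cycle_family X css" "p = cycle_prod css"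
  using assms cycle_family_exists by (auto simp: fin_sym_def)

text \<open>The entrywise bijection from \<open>xs\<close> to \<open>ys\<close> is completed on the
  finite set \<open>A\<close> of all entries: the complements of both lists in \<open>A\<close> have
  equal size. Being the identity off \<open>A\<close>, the result has finite support, as a
  conjugator in \<open>fin_sym X\<close> must.\<close>

lemma permutation_mapping_lists:
  assumes "distinct xs" "distinct ys" "length xs = length ys" "set xs \<subseteq> X" "set ys \<subseteq> X"
  obtains h where "h permutes X" "finite {x. h x \<noteq> x}" "map h xs = ys"
proof -
  define A where "A = set xs \<union> set ys"
  have "card (A - set xs) = card (A - set ys)"
    using assms by (simp add: A_def card_Diff_subset distinct_card)
  then obtain g where g: "bij_betw g (A - set xs) (A - set ys)"
    using finite_same_card_bij[of "A - set xs" "A - set ys"] by (auto simp: A_def)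
  define f where "f = (\<lambda>x. ys ! (inv_into {..<length xs} (\<lambda>i. xs ! i) x))"
  have inj: "inj_on (\<lambda>i. xs ! i) {..<length xs}"
    using assms(1) by (simp add: inj_on_nth)
  have f_nth: "f (xs ! i) = ys ! i" if "i < length xs" for i
    using inv_into_f_f[OF inj] that by (simp add: f_def)
  have f_map: "map f xs = ys"
    using f_nth assms(3) by (auto intro: nth_equalityI)
  have "bij_betw f (set xs) (set ys)"
    unfolding bij_betw_def
  proof
    show "f ` set xs = set ys" using f_map by (metis set_map)
    show "inj_on f (set xs)" using f_map assms(1,2) by (metis distinct_map)
  qed
  define h where "h = (\<lambda>x. if x \<in> set xs then f x else if x \<in> A then g x else x)"
  have h_map: "map h xs = ys"
    using f_map by (simp add: h_def cong: map_cong)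
  have "bij_betw h (set xs) (set ys)"
    using \<open>bij_betw f (set xs) (set ys)\<close> by (rule bij_betw_cong[THEN iffD1, rotated]) (simp add: h_def)
  moreover have "bij_betw h (A - set xs) (A - set ys)"
    using g by (rule bij_betw_cong[THEN iffD1, rotated]) (simp add: h_def)
  ultimately have "bij_betw h (set xs \<union> (A - set xs)) (set ys \<union> (A - set ys))"
    by (rule bij_betw_combine) auto
  then have "bij_betw h A A"
    by (simp add: A_def Un_ac)
  then have "h permutes A"
    by (rule bij_imp_permutes) (simp add: h_def A_def)
  moreover have "A \<subseteq> X" using assms by (simp add: A_def)
  ultimately have "h permutes X" by (rule permutes_subset)
  moreover have "finite {x. h x \<noteq> x}"
    by (rule finite_subset[of _ A]) (auto simp: h_def A_def)
  ultimately show thesis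
    using h_map that by blast
qed

lemma shifted_cycle_type_conjugate:
  assumes "p \<in> carrier (fin_sym X)" "q \<in> conj_class (fin_sym X) p"
  shows "shifted_cycle_type q = shifted_cycle_type p"
proof -
  from assms(2) obtain h where h: "h permutes X" "q = h \<circ> p \<circ> inv_into UNIV h"
    by (auto simp: conj_class_fin_sym)
  from assms(1) obtain css where css: "cycle_family X css" "p = cycle_prod css"
    by (rule cycle_family_of_carrier)
  have "inj h" "bij h"
    using h(1) by (auto intro: permutes_inj permutes_bij)
  have "q = cycle_prod (map (map h) css)"
    using css h \<open>bij h\<close> by (simp add: cycle_family_def cycle_prod_conjugate)
  moreover have "cycle_family X (map (map h) css)"
    using css(1) \<open>inj h\<close> permutes_in_image[OF h(1)]
    by (auto simp: cycle_family_def distinct_map inj_on_def simp flip: map_concat)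
  ultimately show ?thesis
    using css by (simp add: shifted_cycle_type_cycle_prod comp_def)
qed

text \<open>The cycles of \<open>q\<close> are reordered to have the same lengths, one by one, as
  those of \<open>p\<close>. A permutation carrying one concatenated list to the other then respects
  the cuts into cycles and conjugates \<open>p\<close> to \<open>q\<close>.\<close>

lemma conjugate_if_shifted_cycle_type_eq:
  assumes "p \<in> carrier (fin_sym X)" "q \<in> carrier (fin_sym X)"
    "shifted_cycle_type q = shifted_cycle_type p"
  shows "q \<in> conj_class (fin_sym X) p"
proof -
  from assms(1) obtain css where css: "cycle_family X css" "p = cycle_prod css"
    by (rule cycle_family_of_carrier)
  from assms(2) obtain dss where dss: "cycle_family X dss" "q = cycle_prod dss"
    by (rule cycle_family_of_carrier)
  have "mset (map (\<lambda>c. length c - 1) css) = mset (map (\<lambda>c. length c - 1) dss)"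
    using assms(3) css dss by (simp add: shifted_cycle_type_cycle_prod)
  then obtain s where s: "s permutes {..<length dss}"
    "permute_list s (map (\<lambda>c. length c - 1) dss) = map (\<lambda>c. length c - 1) css"
    using mset_eq_permutation by (metis length_map)
  define ess where "ess = permute_list s dss"
  have set_ess: "set ess = set dss" and mset_ess: "mset ess = mset dss"
    using s(1) by (simp_all add: ess_def)
  have "mset (concat ess) = mset (concat dss)"
    using mset_ess by (simp add: mset_concat flip: sum_mset_sum_list)
  then have dist_ess: "distinct (concat ess)"
    using dss(1) mset_eq_imp_distinct_iff by (auto simp: cycle_family_def)
  have ess: "cycle_family X ess"
    using dss(1) dist_ess set_ess by (simp add: cycle_family_def)
  have q: "q = cycle_prod ess"
    using dss ess set_ess by (auto simp: cycle_family_def intro!: cycle_prod_cong)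
  have len: "map (\<lambda>c. length c - 1) ess = map (\<lambda>c. length c - 1) css"
    using s by (simp add: ess_def permute_list_map)
  \<comment> \<open>No list is empty, so \<open>Suc\<close> undoes the truncated subtraction and the
    lengths themselves agree.\<close>
  have "map Suc (map (\<lambda>c. length c - 1) ess) = map length ess"
    using ess by (auto simp: cycle_family_def)
  moreover have "map Suc (map (\<lambda>c. length c - 1) css) = map length css"
    using css(1) by (auto simp: cycle_family_def)
  ultimately have len: "map length ess = map length css"
    using len by metis
  then have "length (concat ess) = length (concat css)"
    by (simp add: length_concat)
  then obtain h where h: "h permutes X" "finite {x. h x \<noteq> x}" "map h (concat css) = concat ess"
    using permutation_mapping_lists[of "concat css" "concat ess" X] css(1) ess
    by (auto simp: cycle_family_def)
  have "map (map h) css = ess"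
  proof (rule concat_injective)
    show "concat (map (map h) css) = concat ess" using h(3) by (simp add: map_concat)
    show "length (map (map h) css) = length ess" using len by (metis length_map)
    have "length (css ! i) = length (ess ! i)" if "i < length css" for i
      using len that by (metis length_map nth_map)
    then show "\<forall>(x, y) \<in> set (zip (map (map h) css) ess). length x = length y"
      by (auto simp: in_set_zip)
  qed
  then have "q = h \<circ> p \<circ> inv_into UNIV h"
    using css q h(1) by (simp add: cycle_family_def cycle_prod_conjugate permutes_bij)
  then show ?thesis
    using h by (auto simp: conj_class_fin_sym)
qed

lemma conj_class_eq_shifted_cycle_type:
  assumes "p \<in> carrier (fin_sym X)"
  shows "conj_class (fin_sym X) p =
    {q \<in> carrier (fin_sym X). shifted_cycle_type q = shifted_cycle_type p}"
proof -
  interpret group "fin_sym X" by (rule group_fin_sym)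
  have "conj_class (fin_sym X) p \<subseteq> carrier (fin_sym X)"
    using assms by (auto simp: conj_class_def)
  then show ?thesis
    using assms shifted_cycle_type_conjugate conjugate_if_shifted_cycle_type_eq by blast
qed

section \<open>Word length with respect to star transpositions\<close>

text \<open>An arbitrary centre and an arbitrary set allow Sym(N) and Sym(n) to be treated
  together.\<close>

definition stars :: "'a \<Rightarrow> 'a set \<Rightarrow> ('a \<Rightarrow> 'a) set" where
  "stars z X = {Transposition.transpose z i | i. i \<in> X \<and> i \<noteq> z}"

text \<open>Words are encoded by their non-central points. The last letter acts first.\<close>

definition star_word :: "'a \<Rightarrow> 'a list \<Rightarrow> 'a \<Rightarrow> 'a" where
  "star_word z is = foldr (\<lambda>i p. Transposition.transpose z i \<circ> p) is id"

lemma star_word_Nil [simp]: "star_word z [] = id"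
  and star_word_Cons [simp]: "star_word z (i # is) = Transposition.transpose z i \<circ> star_word z is"
  by (simp_all add: star_word_def)

lemma star_word_append: "star_word z (is @ js) = star_word z is \<circ> star_word z js"
  by (induction "is") (simp_all add: comp_assoc)

lemma star_word_outside: "x \<noteq> z \<Longrightarrow> x \<notin> set is \<Longrightarrow> star_word z is x = x"
  by (induction "is") (auto simp: transpose_def)

lemma inj_star_word: "inj (star_word z is)"
proof (induction "is")
  case (Cons i "is")
  show ?case
    unfolding star_word_Cons by (rule inj_compose[OF _ Cons]) (simp add: inj_on_def transpose_def)
qed simp

text \<open>Transpositions are their own inverses, so inverses add no generators and words are lists
  of points other than \<open>z\<close>.\<close>

lemma word_length_stars:
  assumes "z \<in> X"
  shows "word_length (fin_sym X) (stars z X) p =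
    (LEAST n. \<exists>is. length is = n \<and> set is \<subseteq> X - {z} \<and> p = star_word z is)"
proof -
  have "Transposition.transpose z i \<in> carrier (fin_sym X)" if "i \<in> X" for i
  proof -
    have "finite {x. Transposition.transpose z i x \<noteq> x}"
      by (rule finite_subset[of _ "{z, i}"]) (auto simp: transpose_def split: if_splits)
    then show ?thesis
      using that assms by (simp add: fin_sym_def permutes_swap_id)
  qed
  then have "inv\<^bsub>fin_sym X\<^esub> t = t" if "t \<in> stars z X" for t
    using that by (auto simp: stars_def inv_fin_sym inv_swap_id)
  then have gens: "stars z X \<union> m_inv (fin_sym X) ` stars z X = Transposition.transpose z ` (X - {z})"
    by (auto simp: stars_def)
  have fold: "foldr (mult (fin_sym X)) (map (Transposition.transpose z) is) \<one>\<^bsub>fin_sym X\<^esub> = star_word z is"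
    for "is" by (induction "is") (simp_all add: fin_sym_def)
  have "(\<exists>ss. length ss = n \<and> set ss \<subseteq> stars z X \<union> m_inv (fin_sym X) ` stars z X
      \<and> p = foldr (mult (fin_sym X)) ss \<one>\<^bsub>fin_sym X\<^esub>) \<longleftrightarrow>
    (\<exists>is. length is = n \<and> set is \<subseteq> X - {z} \<and> p = star_word z is)" for n
  proof
    assume "\<exists>ss. length ss = n \<and> set ss \<subseteq> stars z X \<union> m_inv (fin_sym X) ` stars z X
      \<and> p = foldr (mult (fin_sym X)) ss \<one>\<^bsub>fin_sym X\<^esub>"
    then obtain ss where ss: "length ss = n" "set ss \<subseteq> Transposition.transpose z ` (X - {z})"
      "p = foldr (mult (fin_sym X)) ss \<one>\<^bsub>fin_sym X\<^esub>"
      unfolding gens by blast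
    then have "ss \<in> lists (Transposition.transpose z ` (X - {z}))" by auto
    then obtain "is" where "is \<in> lists (X - {z})" "ss = map (Transposition.transpose z) is"
      unfolding lists_image by blast
    then show "\<exists>is. length is = n \<and> set is \<subseteq> X - {z} \<and> p = star_word z is"
      using ss fold by (intro exI[of _ "is"]) auto
  next
    assume "\<exists>is. length is = n \<and> set is \<subseteq> X - {z} \<and> p = star_word z is"
    then obtain "is" where "length is = n" "set is \<subseteq> X - {z}" "p = star_word z is" by blast
    then show "\<exists>ss. length ss = n \<and> set ss \<subseteq> stars z X \<union> m_inv (fin_sym X) ` stars z X
      \<and> p = foldr (mult (fin_sym X)) ss \<one>\<^bsub>fin_sym X\<^esub>"
      unfolding gens using fold by (intro exI[of _ "map (Transposition.transpose z) is"]) auto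
  qed
  then show ?thesis
    by (simp add: word_length_def)
qed

text \<open>The recursion of \<open>cycle_of_list\<close> splits off the transposition on the left
  and leaves a cycle without \<open>z\<close>. Conjugating by this transposition puts
  \<open>z\<close> in place of \<open>a\<close> and moves the factor to the right, which is why
  \<open>rev\<close> appears in the words below.\<close>

lemma cycle_of_list_star_step:
  assumes "distinct (z # a # cs)"
  shows "cycle_of_list (z # a # cs) = cycle_of_list (z # cs) \<circ> Transposition.transpose z a"
proof -
  let ?t = "Transposition.transpose z a"
  have "map ?t cs = cs"
    using assms by (intro map_idI) (auto simp: transpose_def)
  then have "?t \<circ> cycle_of_list (a # cs) \<circ> inv_into UNIV ?t = cycle_of_list (z # cs)"
    using assms by (subst conjugation_of_cycle) auto
  then have "?t \<circ> cycle_of_list (a # cs) \<circ> ?t \<circ> ?t = cycle_of_list (z # cs) \<circ> ?t"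
    by (simp add: inv_swap_id)
  then show ?thesis
    by (simp add: comp_assoc)
qed

lemma star_word_cycle: "distinct (z # cs) \<Longrightarrow> star_word z (rev cs) = cycle_of_list (z # cs)"
proof (induction cs)
  case (Cons a cs)
  have "star_word z (rev (a # cs)) = cycle_of_list (z # cs) \<circ> Transposition.transpose z a"
    using Cons by (simp add: star_word_append)
  then show ?case
    using cycle_of_list_star_step[OF Cons.prems] by simp
qed simp

text \<open>A cycle through \<open>z\<close> costs one letter for each other point; a cycle avoiding
  \<open>z\<close> costs one letter per point and one repetition. The total is the word length
  (\<open>word_length_cycle_prod\<close>).\<close>

definition star_cost :: "'a \<Rightarrow> 'a list list \<Rightarrow> nat" where
  "star_cost z css = (\<Sum>c\<leftarrow>css. if z \<in> set c then length c - 1 else length c + 1)"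

text \<open>A cycle through \<open>z\<close> is rotated until it starts with \<open>z\<close>.
  Otherwise \<open>z\<close> is put in front, and one further transposition with the first entry
  removes it again; that entry is the repeated letter.\<close>

lemma star_word_of_cycle:
  assumes "distinct c" "c \<noteq> []"
  shows "\<exists>is. set is \<subseteq> set c - {z} \<and> cycle_of_list c = star_word z is
    \<and> length is = (if z \<in> set c then length c - 1 else length c + 1)"
proof (cases "z \<in> set c")
  case True
  then obtain us vs where c: "c = us @ z # vs"
    by (meson split_list)
  then have "rotate (length us) c = z # vs @ us"
    by (simp add: rotate_append)
  then have "cycle_of_list c = cycle_of_list (z # vs @ us)"
    using cycle_of_list_rotate_independent[OF assms(1)] by metis
  also have "\<dots> = star_word z (rev (vs @ us))"
    using assms c by (intro star_word_cycle[symmetric]) auto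
  finally show ?thesis
    using assms c by (intro exI[of _ "rev (vs @ us)"]) auto
next
  case False
  obtain a cs where c: "c = a # cs"
    using assms(2) by (cases c) auto
  have "cycle_of_list c = Transposition.transpose z a \<circ> cycle_of_list (z # c)"
    by (rule ext) (simp add: c)
  also have "\<dots> = star_word z (a # rev c)"
    using False assms star_word_cycle[of z c] by simp
  finally show ?thesis
    using False c by (intro exI[of _ "a # rev c"]) auto
qed

lemma star_word_of_cycle_prod:
  assumes "cycle_family X css"
  shows "\<exists>is. set is \<subseteq> X - {z} \<and> cycle_prod css = star_word z is \<and> length is = star_cost z css"
  using assms
proof (induction css)
  case Nil
  show ?case by (intro exI[of _ "[]"]) (simp add: star_cost_def)
next
  case (Cons c css)
  then have c: "distinct c" "c \<noteq> []" "set c \<subseteq> X" and css: "cycle_family X css"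
    by (auto simp: cycle_family_def)
  obtain us where us: "set us \<subseteq> set c - {z}" "cycle_of_list c = star_word z us"
    "length us = (if z \<in> set c then length c - 1 else length c + 1)"
    using star_word_of_cycle[OF c(1,2)] by blast
  obtain vs where vs: "set vs \<subseteq> X - {z}" "cycle_prod css = star_word z vs"
    "length vs = star_cost z css"
    using Cons.IH[OF css] by blast
  show ?case
    using us vs c(3) by (intro exI[of _ "us @ vs"]) (auto simp: star_word_append star_cost_def)
qed

text \<open>
  If all letters in \<open>C\<close> occurred once, let \<open>x\<close> be the one that acts first, that is, the last one in the
  word. Then the preimage of \<open>x\<close> is the preimage of \<open>z\<close> under the letters acting before \<open>x\<close>, none of
  which lies in \<open>C\<close>; so it cannot lie in \<open>C\<close>.
\<close>

lemma star_word_repeated_letter: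
  assumes "C \<subseteq> set is" "z \<notin> C" "C \<noteq> {}" "C \<subseteq> star_word z is ` C"
  shows "\<exists>x \<in> C. 2 \<le> count_list is x"
proof (rule ccontr)
  assume *: "\<not> (\<exists>x \<in> C. 2 \<le> count_list is x)"
  have "\<exists>x \<in> set is. x \<in> C" using assms by auto
  then obtain us x vs where split: "is = us @ x # vs" "x \<in> C" "\<forall>y \<in> set vs. y \<notin> C"
    by (rule split_list_last_propE) blast
  have "count_list us x = 0"
    using * split(1,2) by force
  then have "x \<notin> set us"
    by (simp add: count_list_0_iff)
  then have u: "star_word z us x = x"
    using split(2) assms(2) by (intro star_word_outside) auto
  obtain y where y: "y \<in> C" "star_word z is y = x"
    using assms(4) split(2) by auto
  have "star_word z vs y = y"
    using y(1) split(3) assms(2) by (intro star_word_outside) auto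
  then have "star_word z us (Transposition.transpose z x y) = star_word z us x"
    using y(2) u by (simp add: split(1) star_word_append)
  then have "Transposition.transpose z x y = x"
    using inj_star_word by (metis injD)
  then have "y = z"
    by (metis transpose_apply_second transpose_involutory)
  then show False using y(1) assms(2) by simp
qed

text \<open>The length of a word is the sum of its letter counts. Disjoint cycles are charged to
  disjoint sets of letters, and each cycle pays at least its cost, with
  \<open>star_word_repeated_letter\<close> supplying the extra letter when \<open>z\<close> is
  avoided.\<close>

lemma star_cost_le_length:
  assumes "cycle_family X css" "z \<notin> set is" "cycle_prod css = star_word z is"
  shows "star_cost z css \<le> length is"
proof -
  have dist: "distinct (concat css)"
    using assms(1) by (simp add: cycle_family_def)
  have letter: "1 \<le> count_list is x" if "x \<in> set (concat css)" "x \<noteq> z" for x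
  proof -
    have "star_word z is x \<noteq> x"
      using that(1) cycle_prod_moved[OF assms(1)] assms(3) by auto
    then have "x \<in> set is"
      using star_word_outside that(2) by metis
    then show ?thesis
      by (metis count_list_0_iff less_one not_le)
  qed
  have cycle: "(if z \<in> set c then length c - 1 else length c + 1) \<le> (\<Sum>x \<in> set c - {z}. count_list is x)"
    if c: "c \<in> set css" for c
  proof -
    have card_c: "card (set c) = length c"
      using dist c by (auto simp: distinct_concat_iff distinct_card)
    have le: "1 \<le> count_list is x" if "x \<in> set c - {z}" for x
      using letter c that by auto
    show ?thesis
    proof (cases "z \<in> set c")
      case True
      have "(\<Sum>x \<in> set c - {z}. 1) \<le> (\<Sum>x \<in> set c - {z}. count_list is x)"
        by (rule sum_mono) (use le in auto)
      then show ?thesis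
        using True card_c by (simp add: card_Diff_singleton)
    next
      case False
      \<comment> \<open>Invariance of the cycle under the word is what
        \<open>star_word_repeated_letter\<close> requires.\<close>
      have "cycle_prod css ` set c = set c"
      proof -
        have "cycle_prod css ` set c = cycle_of_list c ` set c"
          using cycle_prod_inside[OF dist c] by simp
        then show ?thesis
          using permutes_image[OF cycle_permutes] by metis
      qed
      moreover have "set c \<noteq> {}"
        using assms(1) c by (force simp: cycle_family_def)
      moreover have "set c \<subseteq> set is"
      proof
        fix x assume "x \<in> set c"
        with le[of x] False show "x \<in> set is"
          by (metis DiffI count_list_0_iff not_one_le_zero singletonD)
      qed
      ultimately obtain x where x: "x \<in> set c" "2 \<le> count_list is x"
        using star_word_repeated_letter[of "set c" "is" z] False assms(3) by auto
      have "(\<Sum>x \<in> set c. 1) < (\<Sum>x \<in> set c. count_list is x)"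
        by (rule sum_strict_mono_ex1) (use le x False in \<open>auto intro!: bexI[of _ x]\<close>)
      then show ?thesis
        using False card_c by simp
    qed
  qed
  \<comment> \<open>The induction runs over lists \<open>dss\<close> with members in
    \<open>css\<close>, so that the bound \<open>cycle\<close> stays available.\<close>
  have "(\<Sum>c\<leftarrow>dss. if z \<in> set c then length c - 1 else length c + 1)
      \<le> (\<Sum>x \<in> set (concat dss) - {z}. count_list is x)"
    if "distinct (concat dss)" "set dss \<subseteq> set css" for dss
    using that
  proof (induction dss)
    case (Cons c dss)
    have "set (concat (c # dss)) - {z} = (set c - {z}) \<union> (set (concat dss) - {z})"
      by auto
    moreover have "(\<Sum>x \<in> (set c - {z}) \<union> (set (concat dss) - {z}). count_list is x)
       = (\<Sum>x \<in> set c - {z}. count_list is x) + (\<Sum>x \<in> set (concat dss) - {z}. count_list is x)"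
      by (rule sum.union_disjoint) (use Cons.prems in auto)
    ultimately show ?case
      using Cons cycle[of c] by simp
  qed simp
  then have "star_cost z css \<le> (\<Sum>x \<in> set (concat css) - {z}. count_list is x)"
    using dist by (simp add: star_cost_def)
  \<comment> \<open>Letters outside the support only enlarge the sum, and points that are not
    letters count 0.\<close>
  also have "\<dots> \<le> (\<Sum>x \<in> set is \<union> (set (concat css) - {z}). count_list is x)"
    by (rule sum_mono2) auto
  also have "\<dots> = (\<Sum>x \<in> set is. count_list is x)"
    by (rule sum.mono_neutral_right) (auto simp: count_list_0_iff)
  also have "\<dots> = length is"
    by (rule sum_count_set) auto
  finally show ?thesis .
qed

lemma word_length_cycle_prod:
  assumes "z \<in> X" "cycle_family X css"
  shows "word_length (fin_sym X) (stars z X) (cycle_prod css) = star_cost z css"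
  unfolding word_length_stars[OF assms(1)]
proof (rule Least_equality)
  show "\<exists>is. length is = star_cost z css \<and> set is \<subseteq> X - {z} \<and> cycle_prod css = star_word z is"
    using star_word_of_cycle_prod[OF assms(2)] by blast
qed (use star_cost_le_length[OF assms(2)] in blast)

text \<open>Truncated subtraction gives the identity class \<open>{#}\<close> the correct value \<open>0\<close>.\<close>

definition class_cost :: "nat multiset \<Rightarrow> nat" where
  "class_cost M = sum_mset M + 2 * size M - 2"

text \<open>A cycle of length l gives the part l - 1 and adds 2 through \<open>size\<close>, hence l
  + 1 in total.\<close>

lemma class_cost_cycle_family:
  assumes "cycle_family X css"
  shows "class_cost (shifted_cycle_type (cycle_prod css)) = (\<Sum>c\<leftarrow>css. length c + 1) - 2"
proof -
  have "sum_mset (mset (map (\<lambda>c. length c - 1) css)) + 2 * length css = (\<Sum>c\<leftarrow>css. length c + 1)"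
    using assms by (induction css) (auto simp: cycle_family_def)
  then show ?thesis
    using assms by (simp add: class_cost_def shifted_cycle_type_cycle_prod)
qed

text \<open>At most one of the disjoint cycles contains \<open>z\<close>, and it saves 2: l - 1
  instead of l + 1.\<close>

lemma star_cost_eq:
  assumes "distinct (concat css)"
  shows "star_cost z css + (if z \<in> set (concat css) then 2 else 0) = (\<Sum>c\<leftarrow>css. length c + 1)"
  using assms
proof (induction css)
  case (Cons c css)
  have "Suc 0 \<le> length c" if "z \<in> set c"
    using that by (cases c) auto
  then show ?case
    using Cons by (auto simp: star_cost_def disjoint_iff split: if_splits)
qed (simp add: star_cost_def)

text \<open>By \<open>star_cost_eq\<close> no conjugate saves more than 2, and a conjugate that
  moves \<open>z\<close> does save 2.\<close>

lemma conj_length_stars: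
  assumes "z \<in> X" "p \<in> carrier (fin_sym X)"
  shows "conj_length (fin_sym X) (stars z X) p = class_cost (shifted_cycle_type p)"
  unfolding conj_length_def
proof (rule Least_equality)
  fix n
  assume "\<exists>q \<in> conj_class (fin_sym X) p. word_length (fin_sym X) (stars z X) q = n"
  then obtain q where q: "q \<in> conj_class (fin_sym X) p"
    "word_length (fin_sym X) (stars z X) q = n" by blast
  then obtain css where css: "cycle_family X css" "q = cycle_prod css"
    using cycle_family_of_carrier conj_class_eq_shifted_cycle_type[OF assms(2)] by blast
  have "class_cost (shifted_cycle_type p) = class_cost (shifted_cycle_type q)"
    using q shifted_cycle_type_conjugate[OF assms(2)] by simp
  also have "\<dots> \<le> star_cost z css"
    using css class_cost_cycle_family[OF css(1)] star_cost_eq[of css z]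
    by (auto simp: cycle_family_def split: if_splits)
  also have "\<dots> = n"
    using css q(2) word_length_cycle_prod[OF assms(1)] by simp
  finally show "class_cost (shifted_cycle_type p) \<le> n" .
next
  obtain css where css: "cycle_family X css" "p = cycle_prod css"
    using assms(2) by (rule cycle_family_of_carrier)
  \<comment> \<open>Conjugating by the transposition of \<open>z\<close> with a moved point makes
    \<open>z\<close> a moved point. Only the identity has no moved point.\<close>
  obtain q where q: "q \<in> conj_class (fin_sym X) p" "q z \<noteq> z \<or> q = id"
  proof (cases "p = id")
    case True
    then show thesis
      using that[of p] assms(2) by (simp add: conj_class_eq_shifted_cycle_type)
  next
    case False
    then obtain a where a: "p a \<noteq> a" by (auto simp: fun_eq_iff)
    then have "a \<in> X" using assms(2) by (auto simp: fin_sym_def permutes_def)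
    let ?t = "Transposition.transpose z a"
    have "finite {x. ?t x \<noteq> x}"
      by (rule finite_subset[of _ "{z, a}"]) (auto simp: transpose_def split: if_splits)
    moreover have "?t permutes X"
      using assms(1) \<open>a \<in> X\<close> by (rule permutes_swap_id)
    moreover have "(?t \<circ> p \<circ> inv_into UNIV ?t) z \<noteq> z"
      using a by (auto simp: inv_swap_id transpose_def)
    ultimately show thesis
      using that[of "?t \<circ> p \<circ> inv_into UNIV ?t"] unfolding conj_class_fin_sym by blast
  qed
  have "q \<in> carrier (fin_sym X)"
    using q conj_class_eq_shifted_cycle_type[OF assms(2)] by blast
  then obtain dss where dss: "cycle_family X dss" "q = cycle_prod dss"
    by (rule cycle_family_of_carrier)
  have "z \<in> set (concat dss) \<or> dss = []"
  proof (cases "q = id")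
    case True
    then have "set (concat dss) = {}"
      using cycle_prod_moved[OF dss(1)] dss(2) by simp
    then show ?thesis
      using dss(1) by (cases dss) (auto simp: cycle_family_def)
  next
    case False
    then show ?thesis
      using q(2) cycle_prod_moved[OF dss(1)] dss(2) by blast
  qed
  \<comment> \<open>For the identity both sides are 0, on the right by truncated
    subtraction.\<close>
  then have "star_cost z dss = class_cost (shifted_cycle_type q)"
    using class_cost_cycle_family[OF dss(1)] star_cost_eq[of dss z] dss
    by (auto simp: cycle_family_def split: if_splits)
  also have "\<dots> = class_cost (shifted_cycle_type p)"
    using q shifted_cycle_type_conjugate[OF assms(2)] by simp
  finally show "\<exists>q \<in> conj_class (fin_sym X) p.
      word_length (fin_sym X) (stars z X) q = class_cost (shifted_cycle_type p)"
    using q(1) dss(2) word_length_cycle_prod[OF assms(1) dss(1)] by metis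
qed

section \<open>Conjugacy classes indexed by cycle types\<close>

text \<open>A part i stands for a cycle on i + 1 points, so \<open>sum_mset M + size M\<close> is
  the number of moved points; only a finite set bounds it.\<close>

definition cycle_types :: "'a set \<Rightarrow> nat multiset set" where
  "cycle_types X = {M. 0 \<notin># M \<and> (finite X \<longrightarrow> sum_mset M + size M \<le> card X)}"

lemma list_partition_exists:
  "length xs = sum_list ls \<Longrightarrow> \<exists>xss. map length xss = ls \<and> concat xss = xs"
proof (induction ls arbitrary: xs)
  case (Cons l ls)
  then obtain xss where "map length xss = ls" "concat xss = drop l xs"
    using Cons.IH[of "drop l xs"] by fastforce
  then show ?case
    using Cons.prems by (intro exI[of _ "take l xs # xss"]) auto
qed simp

text \<open>To realise a type, as many points of \<open>X\<close> as it moves are listed and cut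
  into blocks of length i + 1, one for each part i.\<close>

lemma shifted_cycle_type_image:
  "shifted_cycle_type ` carrier (fin_sym X) = cycle_types X"
proof (intro equalityI subsetI)
  fix M assume "M \<in> shifted_cycle_type ` carrier (fin_sym X)"
  then obtain css where css: "cycle_family X css" "M = shifted_cycle_type (cycle_prod css)"
    using cycle_family_of_carrier by blast
  then have M: "M = mset (map (\<lambda>c. length c - 1) css)"
    by (simp add: shifted_cycle_type_cycle_prod)
  have "sum_mset M + size M = length (concat css)"
    unfolding M using css(1) by (induction css) (auto simp: cycle_family_def)
  also have "\<dots> = card (set (concat css))"
    using css(1) distinct_card by (metis cycle_family_def)
  finally have "sum_mset M + size M = card (set (concat css))" .
  moreover have "card (set (concat css)) \<le> card X" if "finite X"
    using css(1) that by (intro card_mono) (auto simp: cycle_family_def)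
  moreover have "0 \<notin># M"
    using css(1) by (force simp: M cycle_family_def)
  ultimately show "M \<in> cycle_types X"
    by (simp add: cycle_types_def)
next
  fix M assume M: "M \<in> cycle_types X"
  obtain xs where xs: "mset xs = M"
    using ex_mset by blast
  have "\<exists>T \<subseteq> X. finite T \<and> card T = sum_mset M + size M"
  proof (cases "finite X")
    case True
    then show ?thesis
      using M obtain_subset_with_card_n[of "sum_mset M + size M" X] by (auto simp: cycle_types_def)
  next
    case False
    then show ?thesis
      using infinite_arbitrarily_large by blast
  qed
  then obtain ys where ys: "distinct ys" "set ys \<subseteq> X" "length ys = sum_mset M + size M"
    by (metis distinct_card finite_distinct_list)
  have "sum_list (map Suc xs) = sum_list xs + length xs"
    by (induction xs) auto
  then obtain css where css: "map length css = map Suc xs" "concat css = ys"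
    using list_partition_exists[of ys "map Suc xs"] ys(3) xs by (auto simp: sum_mset_sum_list)
  have pos: "0 \<notin> set xs"
    using M xs by (auto simp: cycle_types_def)
  have "2 \<le> length c" if "c \<in> set css" for c
  proof -
    have "length c \<in> set (map Suc xs)"
      using that css(1) by (metis image_eqI list.set_map)
    then obtain x where "x \<in> set xs" "length c = Suc x" by auto
    then show ?thesis
      using pos by (cases "x = 0") auto
  qed
  then have fam: "cycle_family X css"
    using ys css(2) by (simp add: cycle_family_def)
  have "map (\<lambda>c. length c - 1) css = map (\<lambda>n. n - 1) (map length css)"
    by simp
  also have "\<dots> = xs"
    by (simp add: css(1) comp_def)
  finally have "shifted_cycle_type (cycle_prod css) = M"
    using shifted_cycle_type_cycle_prod[OF fam] xs by simp
  moreover have "cycle_prod css \<in> carrier (fin_sym X)"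
    using fam by (intro cycle_prod_in_carrier) (simp add: cycle_family_def)
  ultimately show "M \<in> shifted_cycle_type ` carrier (fin_sym X)"
    by blast
qed

lemma conj_classes_of_length_stars:
  assumes "z \<in> X"
  shows "conj_classes_of_length (fin_sym X) (stars z X) m =
    (\<lambda>M. {p \<in> carrier (fin_sym X). shifted_cycle_type p = M}) ` {M \<in> cycle_types X. class_cost M = m}"
proof -
  define K where "K M = {p \<in> carrier (fin_sym X). shifted_cycle_type p = M}" for M
  have "conj_classes (fin_sym X) = (\<lambda>p. K (shifted_cycle_type p)) ` carrier (fin_sym X)"
    by (simp add: conj_classes_def conj_class_eq_shifted_cycle_type K_def cong: image_cong)
  then have classes: "conj_classes (fin_sym X) = K ` cycle_types X"
    by (simp add: image_image flip: shifted_cycle_type_image)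
  have "(\<forall>p \<in> K M. conj_length (fin_sym X) (stars z X) p = m) \<longleftrightarrow> class_cost M = m"
    if "M \<in> cycle_types X" for M
  proof -
    \<comment> \<open>Without an element in the fibre, the universal condition on the conjugacy
      length would hold vacuously.\<close>
    have "\<exists>p. p \<in> K M"
      using that by (auto simp: K_def simp flip: shifted_cycle_type_image)
    then show ?thesis
      using conj_length_stars[OF assms] by (auto simp: K_def)
  qed
  then have "conj_classes_of_length (fin_sym X) (stars z X) m = K ` {M \<in> cycle_types X. class_cost M = m}"
    unfolding conj_classes_of_length_def classes by blast
  then show ?thesis
    by (simp add: K_def)
qed

text \<open>Cost m bounds both the sum and the number of parts by m + 2.\<close>

lemma finite_cycle_types_of_cost: "finite {M \<in> cycle_types X. class_cost M = m}"
proof (rule finite_subset)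
  show "{M \<in> cycle_types X. class_cost M = m} \<subseteq>
    (\<Union>k \<le> m + 2. \<Union>j \<le> m + 2. {M :: nat multiset. size M = k \<and> (\<forall>i \<in># M. 0 < i) \<and> sum_mset M = j})"
    by (auto simp: cycle_types_def class_cost_def intro: ccontr)
qed (simp add: finite_partitions)

lemma finite_conj_classes_of_length_stars:
  "z \<in> X \<Longrightarrow> finite (conj_classes_of_length (fin_sym X) (stars z X) m)"
  by (simp add: conj_classes_of_length_stars finite_cycle_types_of_cost)

text \<open>Every type is realised, so fibres over different types are different classes.\<close>

lemma conj_growth_stars:
  assumes "z \<in> X"
  shows "conj_growth (fin_sym X) (stars z X) m = card {M \<in> cycle_types X. class_cost M = m}"
  unfolding conj_growth_def conj_classes_of_length_stars[OF assms]
proof (rule card_image, rule inj_onI)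
  fix M N
  assume "M \<in> {M \<in> cycle_types X. class_cost M = m}"
    and eq: "{p \<in> carrier (fin_sym X). shifted_cycle_type p = M}
      = {p \<in> carrier (fin_sym X). shifted_cycle_type p = N}"
  then obtain p where "p \<in> carrier (fin_sym X)" "shifted_cycle_type p = M"
    by (auto simp flip: shifted_cycle_type_image)
  with eq show "M = N" by auto
qed

section \<open>Counting cycle types\<close>

definition partitions :: "nat \<Rightarrow> nat \<Rightarrow> nat multiset set" where
  "partitions k j = {M. size M = k \<and> (\<forall>i \<in># M. 0 < i) \<and> sum_mset M = j}"

lemma card_partitions: "card (partitions k j) = num_partitions k j"
  by (simp add: partitions_def num_partitions_def)

lemma finite_partitions_set: "finite (partitions k j)"
  unfolding partitions_def by (rule finite_partitions)

lemma size_le_sum_mset: "\<forall>i \<in># M. 0 < i \<Longrightarrow> size M \<le> sum_mset M" for M :: "nat multiset"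
  by (induction M) auto

lemma num_partitions_0: "num_partitions 0 j = (if j = 0 then 1 else 0)"
proof -
  have "partitions 0 j = (if j = 0 then {{#}} else {})"
    by (auto simp: partitions_def)
  then show ?thesis by (simp flip: card_partitions)
qed

lemma num_partitions_less: "j < k \<Longrightarrow> num_partitions k j = 0"
proof -
  assume "j < k"
  then have "partitions k j = {}"
    using size_le_sum_mset by (fastforce simp: partitions_def)
  then show ?thesis by (simp flip: card_partitions)
qed

lemma sum_mset_image_Suc: "sum_mset (image_mset Suc M) = sum_mset M + size M"
  by (induction M) auto

text \<open>The cases are whether 1 is a part. Without it, lowering all \<open>Suc k\<close> parts
  leaves the sum \<open>Suc j - Suc k = j - k\<close>; the guard excludes truncation.\<close>

lemma partitions_Suc_Suc:
  "partitions (Suc k) (Suc j) =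
     add_mset 1 ` partitions k j \<union> (if k \<le> j then image_mset Suc ` partitions (Suc k) (j - k) else {})"
    (is "?L = ?A \<union> ?B")
proof
  show "?A \<union> ?B \<subseteq> ?L"
    by (auto simp: partitions_def sum_mset_image_Suc)
  show "?L \<subseteq> ?A \<union> ?B"
  proof
    fix M assume M: "M \<in> ?L"
    show "M \<in> ?A \<union> ?B"
    proof (cases "1 \<in># M")
      case True
      then obtain N where "M = add_mset 1 N"
        by (metis multi_member_split)
      then show ?thesis using M by (auto simp: partitions_def)
    next
      case False
      define N where "N = image_mset (\<lambda>i. i - 1) M"
      have gt: "1 < i" if "i \<in># M" for i
        using False M that by (metis (mono_tags, lifting) less_one linorder_neqE_nat mem_Collect_eq not_less_zero partitions_def)
      have "image_mset Suc N = image_mset (\<lambda>i. i) M"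
        unfolding N_def image_mset.compositionality by (rule image_mset_cong) (use gt in force)
      then have MN: "M = image_mset Suc N" by simp
      have "\<forall>i \<in># N. 0 < i"
        using gt by (auto simp: N_def)
      moreover have "size N = Suc k" "sum_mset N + Suc k = Suc j"
        using M by (auto simp: MN partitions_def sum_mset_image_Suc)
      ultimately show ?thesis
        using MN by (auto simp: partitions_def)
    qed
  qed
qed

text \<open>Both maps are injective, and their images are disjoint because the successors of
  positive parts exceed 1.\<close>

lemma num_partitions_Suc_Suc:
  "num_partitions (Suc k) (Suc j) =
     num_partitions k j + (if k \<le> j then num_partitions (Suc k) (j - k) else 0)"
proof -
  have "inj (add_mset (1::nat))" "inj (image_mset Suc)"
    by (auto intro: injI multiset.inj_map)
  then have inj: "inj_on (add_mset 1) (partitions k j)" "inj_on (image_mset Suc) (partitions (Suc k) (j - k))"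
    by (auto intro: inj_on_subset)
  have "1 \<notin># image_mset Suc N" if "N \<in> partitions (Suc k) (j - k)" for N
    using that by (auto simp: partitions_def)
  then have "add_mset 1 ` partitions k j \<inter> image_mset Suc ` partitions (Suc k) (j - k) = {}"
    by (metis (no_types, lifting) disjoint_iff imageE union_single_eq_member)
  then show ?thesis
    unfolding card_partitions[symmetric] partitions_Suc_Suc
    by (simp add: card_Un_disjoint finite_partitions_set card_image inj inj(1)[unfolded One_nat_def])
qed

lemma num_partitions_Suc_0: "num_partitions (Suc k) 0 = 0"
  by (rule num_partitions_less) simp

section \<open>Generating functions of partitions with a fixed number of parts\<close>

definition partition_series :: "nat \<Rightarrow> real fps" where
  "partition_series k = Abs_fps (\<lambda>j. of_nat (num_partitions k j))"

text \<open>This is the recurrence of \<open>num_partitions_Suc_Suc\<close> read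
  coefficientwise.\<close>

lemma partition_series_Suc:
  "partition_series (Suc k) * (1 - fps_X ^ Suc k) = fps_X * partition_series k"
proof (rule fps_ext)
  fix n
  have "fps_nth (partition_series (Suc k) * (1 - fps_X ^ Suc k)) n =
     real (num_partitions (Suc k) n) - (if n < Suc k then 0 else real (num_partitions (Suc k) (n - Suc k)))"
    by (simp add: right_diff_distrib partition_series_def fps_X_power_mult_right_nth del: power_Suc)
  also have "\<dots> = fps_nth (fps_X * partition_series k) n"
    by (cases n) (auto simp: num_partitions_Suc_Suc num_partitions_Suc_0 partition_series_def)
  finally show "fps_nth (partition_series (Suc k) * (1 - fps_X ^ Suc k)) n =
    fps_nth (fps_X * partition_series k) n" .
qed

text \<open>Iteration of the preceding identity; \<open>1 - fps_X ^ Suc k\<close> is a unit because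
  its constant term is 1.\<close>

lemma partition_series_eq:
  "partition_series k = fps_X ^ k * (\<Prod>j = 1..k. 1 / (1 - fps_X ^ j))"
proof (induction k)
  case 0
  show ?case
    by (auto simp: partition_series_def num_partitions_0 fps_eq_iff)
next
  case (Suc k)
  define u :: "real fps" where "u = 1 - fps_X ^ Suc k"
  have u: "fps_nth u 0 \<noteq> 0" by (simp add: u_def)
  then have "partition_series (Suc k) = partition_series (Suc k) * u / u"
    by (simp add: fps_divide_unit mult.assoc inverse_mult_eq_1')
  also have "\<dots> = fps_X * partition_series k * (1 / u)"
    unfolding u_def partition_series_Suc using u by (simp add: fps_divide_unit u_def)
  finally show ?case
    by (simp add: Suc.IH u_def mult_ac)
qed

section \<open>Growth series from cycle types sorted by the number of parts\<close>

definition types_of_cost :: "'a set \<Rightarrow> nat \<Rightarrow> nat \<Rightarrow> nat multiset set" where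
  "types_of_cost X m k = {M \<in> cycle_types X. size M = k \<and> sum_mset M + 2 * k - 2 = m}"

lemma cycle_types_pos: "M \<in> cycle_types X \<Longrightarrow> \<forall>i \<in># M. 0 < i"
  by (auto simp: cycle_types_def intro!: gr0I)

text \<open>The slice without parts holds only the identity class, of cost 0; it gives the leading 1
  of the series.\<close>

lemma card_cycle_types_of_cost:
  assumes "\<And>M. M \<in> cycle_types X \<Longrightarrow> class_cost M = m \<Longrightarrow> size M \<le> K"
  shows "card {M \<in> cycle_types X. class_cost M = m} =
    (if m = 0 then 1 else 0) + (\<Sum>k = 1..K. card (types_of_cost X m k))"
proof -
  have "{M \<in> cycle_types X. class_cost M = m} = (\<Union>k \<in> {0..K}. types_of_cost X m k)"
    using assms by (auto simp: types_of_cost_def class_cost_def)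
  also have "card \<dots> = (\<Sum>k = 0..K. card (types_of_cost X m k))"
  proof (rule card_UN_disjoint)
    show "\<forall>k \<in> {0..K}. finite (types_of_cost X m k)"
    proof
      fix k
      show "finite (types_of_cost X m k)"
        by (rule finite_subset[OF _ finite_cycle_types_of_cost[of X m]])
          (auto simp: types_of_cost_def class_cost_def)
    qed
  qed (auto simp: types_of_cost_def)
  also have "\<dots> = card (types_of_cost X m 0) + (\<Sum>k = 1..K. card (types_of_cost X m k))"
    by (simp add: sum.atLeast_Suc_atMost)
  also have "types_of_cost X m 0 = (if m = 0 then {{#}} else {})"
    by (auto simp: types_of_cost_def cycle_types_def)
  finally show ?thesis by simp
qed

lemma types_of_cost_infinite:
  assumes "infinite X" "1 \<le> k"
  shows "types_of_cost X m k = (if 2 * k - 2 \<le> m then partitions k (m - (2 * k - 2)) else {})"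
  using assms by (auto simp: types_of_cost_def partitions_def cycle_types_def intro: gr0I)

text \<open>For k parts of cost m the sum is m - (2k - 2), so the second condition bounds the number
  of moved points.\<close>

lemma types_of_cost_finite:
  assumes "finite X" "1 \<le> k"
  shows "types_of_cost X m k =
    (if 2 * k - 2 \<le> m \<and> m - (2 * k - 2) + k \<le> card X then partitions k (m - (2 * k - 2)) else {})"
  using assms by (auto simp: types_of_cost_def partitions_def cycle_types_def intro: gr0I)

text \<open>Positive parts have sum at least \<open>size M\<close>. Hence only finitely many k
  contribute to a given coefficient.\<close>

lemma three_size_le:
  assumes "M \<in> cycle_types X" "class_cost M = m"
  shows "3 * size M \<le> m + 2"
  using size_le_sum_mset[OF cycle_types_pos[OF assms(1)]] assms(2) by (auto simp: class_cost_def)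

lemma conj_growth_infinite:
  assumes "infinite X" "z \<in> X" "m \<le> 3 * K"
  shows "conj_growth (fin_sym X) (stars z X) m = (if m = 0 then 1 else 0) +
    (\<Sum>k = 1..K. if 2 * k - 2 \<le> m then num_partitions k (m - (2 * k - 2)) else 0)"
proof -
  have "conj_growth (fin_sym X) (stars z X) m =
    (if m = 0 then 1 else 0) + (\<Sum>k = 1..K. card (types_of_cost X m k))"
    unfolding conj_growth_stars[OF assms(2)]
  proof (rule card_cycle_types_of_cost)
    fix M assume "M \<in> cycle_types X" "class_cost M = m"
    then show "size M \<le> K"
      using three_size_le[of M X m] assms(3) by linarith
  qed
  also have "(\<Sum>k = 1..K. card (types_of_cost X m k)) =
    (\<Sum>k = 1..K. if 2 * k - 2 \<le> m then num_partitions k (m - (2 * k - 2)) else 0)"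
    by (rule sum.cong) (simp_all add: types_of_cost_infinite[OF assms(1)] card_partitions)
  finally show ?thesis .
qed

text \<open>Convergence of power series is checked on coefficients: the m-th one of the partial sums
  is constant from \<open>K = m\<close> on.\<close>

lemma conj_growth_series_infinite:
  assumes "infinite X" "z \<in> X"
  shows "(\<lambda>k. fps_X ^ (3 * Suc k - 2) * (\<Prod>j = 1..Suc k. 1 / (1 - fps_X ^ j)) :: real fps) sums
    (conj_growth_series (fin_sym X) (stars z X) - 1)"
  unfolding sums_def
proof (rule tendsto_fpsI)
  fix m
  let ?f = "\<lambda>k. fps_X ^ (3 * Suc k - 2) * (\<Prod>j = 1..Suc k. 1 / (1 - fps_X ^ j)) :: real fps"
  \<comment> \<open>The exponent splits as 2k + (k + 1), and the second summand is absorbed into the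
    series of partitions into k + 1 parts.\<close>
  have f: "?f k = fps_X ^ (2 * k) * partition_series (Suc k)" for k
  proof -
    have "3 * Suc k - 2 = 2 * k + Suc k" by simp
    then show ?thesis
      unfolding partition_series_eq by (simp only: power_add mult.assoc)
  qed
  have f_nth: "fps_nth (?f k) m = (if 2 * k \<le> m then real (num_partitions (Suc k) (m - 2 * k)) else 0)" for k
    unfolding f by (auto simp: fps_X_power_mult_nth partition_series_def)
  have "fps_nth (\<Sum>k<K. ?f k) m = fps_nth (conj_growth_series (fin_sym X) (stars z X) - 1) m"
    if "m \<le> K" for K
  proof -
    have "(\<Sum>k<K. fps_nth (?f k) m) = (\<Sum>k<K. if 2 * k \<le> m then real (num_partitions (Suc k) (m - 2 * k)) else 0)"
      by (simp only: f_nth)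
    also have "\<dots> = (\<Sum>k = 1..K. if 2 * k - 2 \<le> m then real (num_partitions k (m - (2 * k - 2))) else 0)"
      by (rule sum.reindex_bij_witness[of _ "\<lambda>k. k - 1" Suc]) auto
    also have "\<dots> = real (\<Sum>k = 1..K. if 2 * k - 2 \<le> m then num_partitions k (m - (2 * k - 2)) else 0)"
      by (simp add: if_distrib cong: if_cong)
    also have "\<dots> = real (conj_growth (fin_sym X) (stars z X) m) - (if m = 0 then 1 else 0)"
      using conj_growth_infinite[OF assms, of m K] that by simp
    finally show ?thesis
      by (simp only: fps_sum_nth) (simp add: conj_growth_series_def)
  qed
  then show "eventually (\<lambda>K. fps_nth (\<Sum>k<K. ?f k) m =
      fps_nth (conj_growth_series (fin_sym X) (stars z X) - 1) m) sequentially"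
    unfolding eventually_sequentially by blast
qed

text \<open>A non-trivial cycle has at least two points, so k is at most half of
  \<open>card X\<close>. The sum j of the parts satisfies \<open>j + k \<le> card X\<close>, whence
  the upper limit \<open>card X - k\<close>.\<close>

lemma conj_growth_series_finite:
  assumes "finite X" "z \<in> X"
  shows "conj_growth_series (fin_sym X) (stars z X) =
    1 + (\<Sum>k = 1..card X div 2. fps_X ^ (2 * k - 2) *
          (\<Sum>j = k..card X - k. of_nat (num_partitions k j) * fps_X ^ j))"
proof (rule fps_ext)
  fix m
  let ?n = "card X"
  have summand: "fps_nth (fps_X ^ (2 * k - 2) * (\<Sum>j = k..?n - k. of_nat (num_partitions k j) * fps_X ^ j)) m =
      real (card (types_of_cost X m k))" if k: "k \<in> {1..?n div 2}" for k
  proof -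
    let ?j = "m - (2 * k - 2)"
    have "fps_nth (\<Sum>j = k..?n - k. of_nat (num_partitions k j) * fps_X ^ j :: real fps) i =
      (if i \<in> {k..?n - k} then real (num_partitions k i) else 0)" for i
    proof -
      have "fps_nth (of_nat (num_partitions k j) * fps_X ^ j :: real fps) i =
          (if i = j then real (num_partitions k j) else 0)" for j
        by (simp add: fps_of_nat[symmetric])
      then show ?thesis by (simp add: fps_sum_nth)
    qed
    then have "fps_nth (fps_X ^ (2 * k - 2) * (\<Sum>j = k..?n - k. of_nat (num_partitions k j) * fps_X ^ j)) m =
      (if 2 * k - 2 \<le> m \<and> ?j \<in> {k..?n - k} then real (num_partitions k ?j) else 0)"
      by (auto simp: fps_X_power_mult_nth)
    also have "\<dots> = (if 2 * k - 2 \<le> m \<and> ?j + k \<le> ?n then real (num_partitions k ?j) else 0)"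
      using k num_partitions_less[of ?j k] by (cases "?j < k") auto
    also have "\<dots> = real (card (types_of_cost X m k))"
    proof -
      have "1 \<le> k" using k by simp
      then show ?thesis
        unfolding types_of_cost_finite[OF assms(1) \<open>1 \<le> k\<close>]
        by (simp only: card_partitions card.empty of_nat_0 split: if_split) blast
    qed
    finally show ?thesis .
  qed
  have "conj_growth (fin_sym X) (stars z X) m =
    (if m = 0 then 1 else 0) + (\<Sum>k = 1..?n div 2. card (types_of_cost X m k))"
    unfolding conj_growth_stars[OF assms(2)]
  proof (rule card_cycle_types_of_cost)
    fix M assume M: "M \<in> cycle_types X"
    then show "size M \<le> ?n div 2"
      using size_le_sum_mset[OF cycle_types_pos[OF M]] assms(1) by (auto simp: cycle_types_def)
  qed
  then show "fps_nth (conj_growth_series (fin_sym X) (stars z X)) m = fps_nth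
    (1 + (\<Sum>k = 1..?n div 2. fps_X ^ (2 * k - 2) *
          (\<Sum>j = k..?n - k. of_nat (num_partitions k j) * fps_X ^ j))) m"
  proof -
    have "fps_nth (\<Sum>k = 1..?n div 2. fps_X ^ (2 * k - 2) *
          (\<Sum>j = k..?n - k. of_nat (num_partitions k j) * fps_X ^ j)) m =
        (\<Sum>k = 1..?n div 2. real (card (types_of_cost X m k)))"
      unfolding fps_sum_nth[of _ "{1..?n div 2}"] by (rule sum.cong[OF refl summand])
    then show ?thesis
      using \<open>conj_growth (fin_sym X) (stars z X) m = _\<close>
      unfolding conj_growth_series_def fps_nth_Abs_fps fps_add_nth by (simp only:) simp
  qed
qed

text \<open>A type of cost m with k \<ge> 1 parts moves m + 2 - k \<le> m + 1 points, so it fits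
  into \<open>X\<close> and both groups have the same types of cost m.\<close>

lemma conj_growth_stable:
  assumes "finite X" "x \<in> X" "infinite Y" "y \<in> Y" "m < card X"
  shows "conj_growth (fin_sym X) (stars x X) m = conj_growth (fin_sym Y) (stars y Y) m"
proof -
  have "sum_mset M + size M \<le> card X" if "class_cost M = m" for M
    using that assms(5) by (cases "M = {#}") (auto simp: class_cost_def Suc_le_eq[symmetric] simp flip: size_eq_0_iff_empty)
  then have "{M \<in> cycle_types X. class_cost M = m} = {M \<in> cycle_types Y. class_cost M = m}"
    using assms(1,3) by (auto simp: cycle_types_def)
  then show ?thesis
    using assms(2,4) by (simp add: conj_growth_stars)
qed

section \<open>Numerical coefficients\<close>

text \<open>An executable form of the recurrence for \<open>num_partitions\<close>.\<close>

fun count_partitions :: "nat \<Rightarrow> nat \<Rightarrow> nat" where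
  "count_partitions 0 j = (if j = 0 then 1 else 0)"
| "count_partitions (Suc k) 0 = 0"
| "count_partitions (Suc k) (Suc j) =
     count_partitions k j + (if k \<le> j then count_partitions (Suc k) (j - k) else 0)"

lemma num_partitions_eq_count_partitions: "num_partitions k j = count_partitions k j"
  by (induction k j rule: count_partitions.induct)
    (simp_all add: num_partitions_0 num_partitions_Suc_0 num_partitions_Suc_Suc)

text \<open>Up to 8 parts suffice, because m \<le> 24 = 3 * 8 as \<open>conj_growth_infinite\<close>
  requires.\<close>

lemma first_coefficients:
  "map (\<lambda>m. (if m = 0 then 1 else 0) +
      (\<Sum>k\<leftarrow>[1..<9]. if 2 * k - 2 \<le> m then count_partitions k (m - (2 * k - 2)) else 0)) [0..<25] =
    [1, 1, 1, 1, 2, 2, 3, 4, 5, 6, 9, 10, 13, 17, 21, 25, 33, 39, 49, 60, 73, 88, 110, 130, 158]"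
  by code_simp

lemma star_gens_nat_eq: "star_gens_nat = stars 0 UNIV"
  by (auto simp: star_gens_nat_def stars_def Suc_le_eq)

lemma star_gens_eq: "1 \<le> n \<Longrightarrow> star_gens n = stars 0 {..<n}"
  unfolding star_gens_def stars_def by force

theorem proposition9:
  shows
    "((\<forall>m. finite (conj_classes_of_length (fin_sym UNIV) star_gens_nat m)) \<and>
      summable (\<lambda>k. fps_X ^ (3 * Suc k - 2) * (\<Prod>j = 1..Suc k. 1 / (1 - fps_X ^ j)) :: real fps) \<and>
      conj_growth_series (fin_sym UNIV) star_gens_nat =
       1 + (\<Sum>k. fps_X ^ (3 * Suc k - 2) * (\<Prod>j = 1..Suc k. 1 / (1 - fps_X ^ j))) \<and>
      map (fps_nth (conj_growth_series (fin_sym UNIV) star_gens_nat)) [0..<25] =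
       [1, 1, 1, 1, 2, 2, 3, 4, 5, 6, 9, 10, 13, 17, 21, 25, 33, 39, 49, 60, 73, 88, 110, 130, 158]) \<and>
     (\<forall>n \<ge> 1.
       (\<forall>m. finite (conj_classes_of_length (fin_sym {..<n}) (star_gens n) m)) \<and>
       conj_growth_series (fin_sym {..<n}) (star_gens n) =
         1 + (\<Sum>k = 1..n div 2. fps_X ^ (2 * k - 2) *
                (\<Sum>j = k..n - k. of_nat (num_partitions k j) * fps_X ^ j))) \<and>
     (\<forall>m. (\<lambda>n. fps_nth (conj_growth_series (fin_sym {..<n}) (star_gens n)) m)
       \<longlonglongrightarrow> fps_nth (conj_growth_series (fin_sym UNIV) star_gens_nat) m)"
proof (intro conjI allI impI)
  fix m
  show "finite (conj_classes_of_length (fin_sym UNIV) star_gens_nat m)"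
    unfolding star_gens_nat_eq by (rule finite_conj_classes_of_length_stars) simp
next
  have sums: "(\<lambda>k. fps_X ^ (3 * Suc k - 2) * (\<Prod>j = 1..Suc k. 1 / (1 - fps_X ^ j)) :: real fps) sums
    (conj_growth_series (fin_sym UNIV) star_gens_nat - 1)"
    unfolding star_gens_nat_eq by (rule conj_growth_series_infinite) simp_all
  show "summable (\<lambda>k. fps_X ^ (3 * Suc k - 2) * (\<Prod>j = 1..Suc k. 1 / (1 - fps_X ^ j)) :: real fps)"
    using sums by (rule sums_summable)
  show "conj_growth_series (fin_sym UNIV) star_gens_nat =
    1 + (\<Sum>k. fps_X ^ (3 * Suc k - 2) * (\<Prod>j = 1..Suc k. 1 / (1 - fps_X ^ j)))"
    unfolding sums_unique[OF sums, symmetric] by simp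
next
  have "map (conj_growth (fin_sym UNIV) star_gens_nat) [0..<25] =
    map (\<lambda>m. (if m = 0 then 1 else 0) +
      (\<Sum>k\<leftarrow>[1..<9]. if 2 * k - 2 \<le> m then count_partitions k (m - (2 * k - 2)) else 0)) [0..<25]"
  proof (rule map_cong[OF refl])
    fix m :: nat
    assume "m \<in> set [0..<25]"
    then have "conj_growth (fin_sym UNIV) star_gens_nat m = (if m = 0 then 1 else 0) +
      (\<Sum>k = 1..8. if 2 * k - 2 \<le> m then num_partitions k (m - (2 * k - 2)) else 0)"
      unfolding star_gens_nat_eq by (intro conj_growth_infinite) simp_all
    \<comment> \<open>The set sum is turned into the list sum that was evaluated.\<close>
    moreover have "{1..8} = set [1..<9::nat]" by auto
    ultimately show "conj_growth (fin_sym UNIV) star_gens_nat m = (if m = 0 then 1 else 0) +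
      (\<Sum>k\<leftarrow>[1..<9]. if 2 * k - 2 \<le> m then count_partitions k (m - (2 * k - 2)) else 0)"
      by (simp only: sum.distinct_set_conv_list distinct_upt num_partitions_eq_count_partitions)
  qed
  then have "map real (map (conj_growth (fin_sym UNIV) star_gens_nat) [0..<25]) =
    map real [1, 1, 1, 1, 2, 2, 3, 4, 5, 6, 9, 10, 13, 17, 21, 25, 33, 39, 49, 60, 73, 88, 110, 130, 158]"
    by (simp only: first_coefficients)
  moreover have "map (fps_nth (conj_growth_series (fin_sym UNIV) star_gens_nat)) [0..<25] =
    map real (map (conj_growth (fin_sym UNIV) star_gens_nat) [0..<25])"
    by (simp add: conj_growth_series_def)
  ultimately show "map (fps_nth (conj_growth_series (fin_sym UNIV) star_gens_nat)) [0..<25] =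
    [1, 1, 1, 1, 2, 2, 3, 4, 5, 6, 9, 10, 13, 17, 21, 25, 33, 39, 49, 60, 73, 88, 110, 130, 158]"
    by (simp only: list.map of_nat_numeral of_nat_1)
next
  fix n m :: nat
  assume n: "1 \<le> n"
  show "finite (conj_classes_of_length (fin_sym {..<n}) (star_gens n) m)"
    unfolding star_gens_eq[OF n] by (rule finite_conj_classes_of_length_stars) (use n in simp)
next
  fix n :: nat
  assume n: "1 \<le> n"
  show "conj_growth_series (fin_sym {..<n}) (star_gens n) =
    1 + (\<Sum>k = 1..n div 2. fps_X ^ (2 * k - 2) *
           (\<Sum>j = k..n - k. of_nat (num_partitions k j) * fps_X ^ j))"
    using conj_growth_series_finite[of "{..<n}" 0] n by (simp add: star_gens_eq)
next
  fix m
  \<comment> \<open>The m-th coefficient is constant from n = m + 1 on, which gives the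
    limit.\<close>
  have "fps_nth (conj_growth_series (fin_sym {..<n}) (star_gens n)) m =
      fps_nth (conj_growth_series (fin_sym UNIV) star_gens_nat) m" if "Suc m \<le> n" for n
    using that conj_growth_stable[of "{..<n}" 0 "UNIV :: nat set" 0 m]
    by (simp add: conj_growth_series_def star_gens_eq star_gens_nat_eq)
  then have "eventually (\<lambda>n. fps_nth (conj_growth_series (fin_sym {..<n}) (star_gens n)) m =
      fps_nth (conj_growth_series (fin_sym UNIV) star_gens_nat) m) sequentially"
    unfolding eventually_sequentially by blast
  then show "(\<lambda>n. fps_nth (conj_growth_series (fin_sym {..<n}) (star_gens n)) m)
      \<longlonglongrightarrow> fps_nth (conj_growth_series (fin_sym UNIV) star_gens_nat) m"
    by (rule tendsto_eventually)
qed

end
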